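(* Let $H$ be a graph and suppose that the class of $\{2K_2,H\}$-free graphs admits the $\chi$-binding function $f$, i.e. $\chi(G')\leq f(\omega(G'))$ for every $\{2K_2,H\}$-free graph $G'$. Then every connected $\{\text{butterfly},\text{hammer},H\}$-free graph $G$ with $\omega(G)\neq 2$ satisfies $\chi(G)\leq f(\omega(G))+3$.
   Context: All graphs are simple, finite and undirected. $\omega(G)$ is the clique number and $\chi(G)$ the chromatic number of $G$. For a family $\mathcal{F}$ of graphs, $G$ is $\mathcal{F}$-free if it has no induced subgraph isomorphic to a member of $\mathcal{F}$. The butterfly is the graph on five vertices consisting of two triangles sharing exactly one vertex (with no other edges). The hammer is the graph on five vertices $a,b,c,d,e$ with edges $ab,bc,ac,cd,de$. $2K_2$ is the disjoint union of two copies of $K_2$. *)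

theory Defs
  imports Complex_Main "Graph_Theory.Graph_Theory"
begin

text \<open>
  Finite simple undirected graphs are the symmetric, loop-free, finite digraphs of the locale
  \<open>pair_graph\<close>: the undirected edge $uv$ is the pair of arcs $(u,v)$, $(v,u)$.
\<close>

definition undirected :: "'a set \<Rightarrow> 'a rel \<Rightarrow> 'a pair_pre_digraph" where
  "undirected V E = mk_symmetric (with_proj \<lparr>pverts = V, parcs = E\<rparr>)"

definition two_K2 :: "nat pair_pre_digraph" where
  "two_K2 = undirected {0, 1, 2, 3} {(0,1), (2,3)}"

text \<open>The two triangles of the butterfly share the vertex 0.\<close>

definition butterfly :: "nat pair_pre_digraph" where
  "butterfly = undirected {0, 1, 2, 3, 4} {(0,1), (0,2), (1,2), (0,3), (0,4), (3,4)}"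

text \<open>The vertices $a,b,c,d,e$ of the hammer are numbered 0 to 4.\<close>

definition hammer :: "nat pair_pre_digraph" where
  "hammer = undirected {0, 1, 2, 3, 4} {(0,1), (1,2), (0,2), (2,3), (3,4)}"

definition induced_free :: "'h pair_pre_digraph \<Rightarrow> 'a pair_pre_digraph \<Rightarrow> bool" where
  "induced_free H G \<longleftrightarrow>
     \<not> (\<exists>S :: 'a pair_pre_digraph.
          induced_subgraph (with_proj S) (with_proj G) \<and> digraph_iso (with_proj S) (with_proj H))"

definition is_clique :: "'a pair_pre_digraph \<Rightarrow> 'a set \<Rightarrow> bool" where
  "is_clique G K \<longleftrightarrow> K \<subseteq> pverts G \<and> (\<forall>u\<in>K. \<forall>v\<in>K. u \<noteq> v \<longrightarrow> (u, v) \<in> parcs G)"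

definition clique_number :: "'a pair_pre_digraph \<Rightarrow> nat" where
  "clique_number G = Max (card ` {K. is_clique G K})"

definition colorable :: "'a pair_pre_digraph \<Rightarrow> nat \<Rightarrow> bool" where
  "colorable G k \<longleftrightarrow>
     (\<exists>c :: 'a \<Rightarrow> nat. (\<forall>v\<in>pverts G. c v < k) \<and> (\<forall>(u, v)\<in>parcs G. c u \<noteq> c v))"

definition chromatic_number :: "'a pair_pre_digraph \<Rightarrow> nat" where
  "chromatic_number G = (LEAST k. colorable G k)"

text \<open>
  A class of graphs is a predicate on graphs with vertices in \<open>nat\<close>. For a class closed under
  isomorphism this loses nothing, as every finite graph has an isomorphic copy there; bounding
  only the graphs over a fixed, possibly finite, vertex type would be a different condition.
\<close>

definition chi_binding :: "(nat pair_pre_digraph \<Rightarrow> bool) \<Rightarrow> (nat \<Rightarrow> real) \<Rightarrow> bool" where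
  "chi_binding \<C> f \<longleftrightarrow>
     (\<forall>G. pair_graph G \<and> \<C> G \<longrightarrow> real (chromatic_number G) \<le> f (clique_number G))"

end

theory Submission
  imports Defs
begin

text \<open>
  Let \<open>T = {p, q, r}\<close> be a triangle inside a maximum clique \<open>K\<close>. If \<open>xy\<close> and \<open>zw\<close> form an induced
  \<open>2K\<^sub>2\<close>, then excluding the butterfly and the hammer forces every vertex to be nonadjacent to at
  least two of \<open>x, y, z, w\<close>. Hence the vertices nonadjacent to at most one member of \<open>T\<close> induce a
  \<open>2K\<^sub>2\<close>-free graph: otherwise six nonadjacent pairs would have to be shared among four vertices. This
  induced subgraph contains \<open>K\<close>, so \<open>f\<close> is evaluated at the right clique number although it is not
  assumed to be monotone. The other vertices miss both members of one of the three pairs in \<open>T\<close>, and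
  the common nonneighbours of such a pair are independent: an edge among them would give a hammer
  or a butterfly with \<open>T\<close>, or would lie so far from \<open>T\<close> that connectivity produces one elsewhere.
\<close>

section \<open>Induced copies\<close>

text \<open>A vertex map alone describes an induced copy here, because arcs are pairs of vertices.
  Such maps compose across different vertex types, and no arc, head or tail maps have to be carried
  along.\<close>

definition embeds :: "'h pair_pre_digraph \<Rightarrow> 'a pair_pre_digraph \<Rightarrow> bool" where
  "embeds H G \<longleftrightarrow> (\<exists>g. inj_on g (pverts H) \<and> g ` pverts H \<subseteq> pverts G \<and>
     (\<forall>u\<in>pverts H. \<forall>v\<in>pverts H. (u, v) \<in> parcs H \<longleftrightarrow> (g u, g v) \<in> parcs G))"

lemma embeds_trans:
  assumes "embeds H G" "embeds G F"
  shows "embeds H F"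
proof -
  obtain g where g: "inj_on g (pverts H)" "g ` pverts H \<subseteq> pverts G"
      "\<And>u v. u \<in> pverts H \<Longrightarrow> v \<in> pverts H \<Longrightarrow> (u, v) \<in> parcs H \<longleftrightarrow> (g u, g v) \<in> parcs G"
    using assms(1) unfolding embeds_def by metis
  obtain h where h: "inj_on h (pverts G)" "h ` pverts G \<subseteq> pverts F"
      "\<And>u v. u \<in> pverts G \<Longrightarrow> v \<in> pverts G \<Longrightarrow> (u, v) \<in> parcs G \<longleftrightarrow> (h u, h v) \<in> parcs F"
    using assms(2) unfolding embeds_def by metis
  show ?thesis
    unfolding embeds_def
  proof (intro exI[of _ "h \<circ> g"] conjI ballI)
    show "inj_on (h \<circ> g) (pverts H)"
      using g(1,2) h(1) by (blast intro: comp_inj_on inj_on_subset)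
    show "(h \<circ> g) ` pverts H \<subseteq> pverts F"
      using g(2) h(2) by (auto simp: image_subset_iff)
    fix u v assume "u \<in> pverts H" "v \<in> pverts H"
    then show "(u, v) \<in> parcs H \<longleftrightarrow> ((h \<circ> g) u, (h \<circ> g) v) \<in> parcs F"
      using g(2) g(3)[of u v] h(3)[of "g u" "g v"] by auto
  qed
qed

lemma embedsI_digraph_iso:
  assumes "induced_subgraph (with_proj S) (with_proj G)"
    and "digraph_iso (with_proj S) (with_proj H)"
  shows "embeds H G"
proof -
  have S: "pverts S \<subseteq> pverts G" "pair_wf_digraph S"
      "parcs S = {e \<in> parcs G. fst e \<in> pverts S \<and> snd e \<in> pverts S}"
    using assms(1) by (auto simp: induced_subgraph_def subgraph_def wf_digraph_wp_iff)
  \<comment> \<open>The isomorphism is reversed so that its vertex map starts at \<open>H\<close>,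
    as \<open>embeds\<close> requires.\<close>
  have "digraph_iso (with_proj H) (with_proj S)"
    using assms(2) S(2) by (simp add: digraph_iso_swap wf_digraph_wp_iff)
  then obtain h where h: "pre_digraph.digraph_isomorphism (with_proj H) h"
      "with_proj S = app_iso h (with_proj H)"
    unfolding digraph_iso_def by blast
  have inj: "inj_on (iso_verts h) (pverts H)"
    using h(1) by (simp add: pre_digraph.digraph_isomorphism_def)
  have wfH: "pair_wf_digraph H"
    using h(1) by (simp add: pre_digraph.digraph_isomorphism_def wf_digraph_wp_iff)
  have V: "pverts S = iso_verts h ` pverts H"
    using arg_cong[OF h(2), of verts] by simp
  have A: "parcs S = iso_arcs h ` parcs H"
    using arg_cong[OF h(2), of arcs] by simp
  \<comment> \<open>Tail and head in \<open>with_proj S\<close> are the projections. This fixes two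
    fields of \<open>h\<close> and forces its arc map to apply the vertex map to both ends.\<close>
  have ht: "iso_tail h = fst" "iso_head h = snd"
    using arg_cong[OF h(2), of tail] arg_cong[OF h(2), of head] by simp_all
  have arc: "iso_arcs h e = (iso_verts h (fst e), iso_verts h (snd e))" if "e \<in> parcs H" for e
    using h(1) that by (auto simp: pre_digraph.digraph_isomorphism_def ht prod_eq_iff)
  have "(u, v) \<in> parcs H \<longleftrightarrow> (iso_verts h u, iso_verts h v) \<in> parcs G"
    if uv: "u \<in> pverts H" "v \<in> pverts H" for u v
  proof
    assume "(u, v) \<in> parcs H"
    then show "(iso_verts h u, iso_verts h v) \<in> parcs G"
      using A S(3) arc[of "(u, v)"] by (metis (no_types, lifting) fst_conv imageI mem_Collect_eq snd_conv)
  next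
    assume "(iso_verts h u, iso_verts h v) \<in> parcs G"
    then have "(iso_verts h u, iso_verts h v) \<in> parcs S"
      using S(3) V uv by auto
    then obtain e where e: "e \<in> parcs H" "(iso_verts h u, iso_verts h v) = iso_arcs h e"
      using A by auto
    have "fst e \<in> pverts H" "snd e \<in> pverts H"
      using wfH e(1) by (simp_all add: pair_wf_digraph.arc_fst_in_verts pair_wf_digraph.arc_snd_in_verts)
    then have "fst e = u" "snd e = v"
      using e arc[OF e(1)] uv inj by (auto dest: inj_onD)
    then show "(u, v) \<in> parcs H"
      using e(1) by auto
  qed
  then show ?thesis
    unfolding embeds_def using inj V S(1) by blast
qed

lemma digraph_isoI_embedding:
  assumes wf: "pair_wf_digraph H" and inj: "inj_on g (pverts H)"
    and arcs: "parcs S = map_prod g g ` parcs H" and verts: "pverts S = g ` pverts H"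
  shows "digraph_iso (with_proj H) (with_proj S)"
proof -
  let ?h = "\<lparr>iso_verts = g, iso_arcs = map_prod g g, iso_head = snd, iso_tail = fst\<rparr>"
  \<comment> \<open>Arcs stay between vertices, so injectivity of \<open>g\<close> on vertices
    carries over to the arc map.\<close>
  have "parcs H \<subseteq> pverts H \<times> pverts H"
    using wf by (auto simp: pair_wf_digraph_def mem_Times_iff)
  then have "inj_on (map_prod g g) (parcs H)"
    using map_prod_inj_on[OF inj inj] inj_on_subset by blast
  then have "pre_digraph.digraph_isomorphism (with_proj H) ?h"
    using wf inj by (auto simp: pre_digraph.digraph_isomorphism_def wf_digraph_wp_iff)
  moreover have "with_proj S = app_iso ?h (with_proj H)"
    using arcs verts by (simp add: app_iso_def with_proj_def)
  ultimately show ?thesis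
    unfolding digraph_iso_def by blast
qed

lemma induced_free_iff_not_embeds:
  assumes H: "pair_wf_digraph H" and G: "pair_wf_digraph G"
  shows "induced_free H G \<longleftrightarrow> \<not> embeds H G"
proof -
  have "\<exists>S. induced_subgraph (with_proj S) (with_proj G) \<and> digraph_iso (with_proj S) (with_proj H)"
    if emb: "embeds H G"
  proof -
    obtain g where g: "inj_on g (pverts H)" "g ` pverts H \<subseteq> pverts G"
        "\<And>u v. u \<in> pverts H \<Longrightarrow> v \<in> pverts H \<Longrightarrow> (u, v) \<in> parcs H \<longleftrightarrow> (g u, g v) \<in> parcs G"
      using emb unfolding embeds_def by metis
    define S where "S = \<lparr>pverts = g ` pverts H, parcs = map_prod g g ` parcs H\<rparr>"
    have HV: "u \<in> pverts H \<and> v \<in> pverts H" if "(u, v) \<in> parcs H" for u v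
      using H that by (auto simp: pair_wf_digraph_def)
    have wfS: "pair_wf_digraph S"
      using HV by unfold_locales (auto simp: S_def)
    have "parcs S = {e \<in> parcs G. fst e \<in> pverts S \<and> snd e \<in> pverts S}"
    proof (rule set_eqI)
      fix e
      show "e \<in> parcs S \<longleftrightarrow> e \<in> {e \<in> parcs G. fst e \<in> pverts S \<and> snd e \<in> pverts S}"
      proof
        assume "e \<in> parcs S"
        then obtain u v where uv: "(u, v) \<in> parcs H" "e = (g u, g v)"
          by (auto simp: S_def)
        then show "e \<in> {e \<in> parcs G. fst e \<in> pverts S \<and> snd e \<in> pverts S}"
          using HV[OF uv(1)] g(3)[of u v] by (simp add: S_def)
      next
        assume "e \<in> {e \<in> parcs G. fst e \<in> pverts S \<and> snd e \<in> pverts S}"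
        then obtain u v where uv: "u \<in> pverts H" "v \<in> pverts H" "e = (g u, g v)" "e \<in> parcs G"
          by (cases e) (auto simp: S_def)
        then have "(u, v) \<in> parcs H"
          using g(3)[of u v] by simp
        then show "e \<in> parcs S"
          using uv(3) by (auto simp: S_def)
      qed
    qed
    then have "induced_subgraph (with_proj S) (with_proj G)"
      using g(2) wfS G
      by (auto simp: induced_subgraph_def subgraph_def wf_digraph_wp_iff compatible_def S_def)
    moreover have "digraph_iso (with_proj S) (with_proj H)"
      using H digraph_isoI_embedding[OF H g(1), of S]
      by (simp add: digraph_iso_swap wf_digraph_wp_iff S_def)
    ultimately show ?thesis by blast
  qed
  then show ?thesis
    unfolding induced_free_def using embedsI_digraph_iso by blast
qed

section \<open>Adjacency in the concrete graphs\<close>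

lemma pair_wf_digraph_undirected:
  assumes "\<And>u v. (u, v) \<in> E \<Longrightarrow> u \<in> V \<and> v \<in> V"
  shows "pair_wf_digraph (undirected V E)"
  using assms by unfold_locales (force simp: undirected_def parcs_mk_symmetric)+

lemma pverts_undirected: "pverts (undirected V E) = V"
  by (simp add: undirected_def)

lemma parcs_undirected: "(u, v) \<in> parcs (undirected V E) \<longleftrightarrow> (u, v) \<in> E \<or> (v, u) \<in> E"
  by (auto simp: undirected_def parcs_mk_symmetric intro: bexI[of _ "(v, u)"])

lemma wf_two_K2: "pair_wf_digraph two_K2"
  and wf_butterfly: "pair_wf_digraph butterfly"
  and wf_hammer: "pair_wf_digraph hammer"
  unfolding two_K2_def butterfly_def hammer_def by (rule pair_wf_digraph_undirected; auto)+

lemma (in pair_graph) arc_commute: "(u, v) \<in> parcs G \<longleftrightarrow> (v, u) \<in> parcs G"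
  using arcs_symmetric by blast

lemma (in pair_graph) arc_irrefl: "(u, u) \<notin> parcs G"
  using no_loops' by blast

section \<open>Connected graphs without butterflies and hammers\<close>

locale butterfly_hammer_free = pair_graph G for G :: "'a pair_pre_digraph" +
  assumes connected: "connected (with_proj G)"
    and butterfly: "induced_free butterfly G"
    and hammer: "induced_free hammer G"
begin

abbreviation adj :: "'a \<Rightarrow> 'a \<Rightarrow> bool" (infix "\<sim>" 50) where
  "u \<sim> v \<equiv> (u, v) \<in> parcs G"

lemma no_butterfly:
  assumes "a \<sim> b" "a \<sim> c" "b \<sim> c" "a \<sim> d" "a \<sim> e" "d \<sim> e"
    and "\<not> b \<sim> d" "\<not> b \<sim> e" "\<not> c \<sim> d" "\<not> c \<sim> e"
  shows False
proof -
  let ?g = "\<lambda>i::nat. [a, b, c, d, e] ! i"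
  note sym = assms(1-6)[THEN arcs_symmetric]
  have nsym: "\<not> d \<sim> b" "\<not> e \<sim> b" "\<not> d \<sim> c" "\<not> e \<sim> c"
    using assms(7-10) arcs_symmetric by blast+
  \<comment> \<open>Adjacent vertices differ as there are no loops. Identifying two nonadjacent ones
    would turn an assumed edge into a forbidden one: \<open>b = d\<close> turns
    \<open>d \<sim> e\<close> into \<open>b \<sim> e\<close>.\<close>
  have ne: "distinct [a, b, c, d, e]"
    using assms sym nsym arc_irrefl by auto
  have "embeds butterfly G"
    unfolding embeds_def butterfly_def pverts_undirected
    \<comment> \<open>The reversed list supplies every inequality in the other orientation for the
      simplifier.\<close>
    using ne distinct_rev[THEN iffD2, OF ne]
    by (intro exI[of _ ?g])
      (simp add: parcs_undirected inj_on_def assms sym nsym arc_irrefl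
        assms(1,2,3,4,5)[THEN in_arcsD1] sym[THEN in_arcsD1])
  then show False
    using butterfly induced_free_iff_not_embeds[OF wf_butterfly pair_wf_digraph] by blast
qed

lemma no_hammer:
  assumes "a \<sim> b" "b \<sim> c" "a \<sim> c" "c \<sim> d" "d \<sim> e"
    and "\<not> a \<sim> d" "\<not> b \<sim> d" "\<not> a \<sim> e" "\<not> b \<sim> e" "\<not> c \<sim> e"
  shows False
proof -
  let ?g = "\<lambda>i::nat. [a, b, c, d, e] ! i"
  note sym = assms(1-5)[THEN arcs_symmetric]
  have nsym: "\<not> d \<sim> a" "\<not> d \<sim> b" "\<not> e \<sim> a" "\<not> e \<sim> b" "\<not> e \<sim> c"
    using assms(6-10) arcs_symmetric by blast+
  have ne: "distinct [a, b, c, d, e]"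
    using assms sym nsym arc_irrefl by auto
  have "embeds hammer G"
    unfolding embeds_def hammer_def pverts_undirected
    using ne distinct_rev[THEN iffD2, OF ne]
    by (intro exI[of _ ?g])
      (simp add: parcs_undirected inj_on_def assms sym nsym arc_irrefl
        assms(1,2,3,4,5)[THEN in_arcsD1] sym[THEN in_arcsD1])
  then show False
    using hammer induced_free_iff_not_embeds[OF wf_hammer pair_wf_digraph] by blast
qed

section \<open>Edges far from a triangle and common nonneighbours\<close>

lemma reachable_in_connected:
  assumes "u \<in> pverts G" "v \<in> pverts G"
  shows "(u, v) \<in> (parcs G)\<^sup>*"
proof -
  \<comment> \<open>Connectedness is defined through the symmetric closure, which adds nothing to a
    symmetric graph.\<close>
  have "parcs (mk_symmetric (with_proj G)) = parcs G"
    using arc_commute by (force simp: parcs_mk_symmetric)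
  moreover have "u \<rightarrow>\<^sup>*\<^bsub>with_proj (mk_symmetric (with_proj G))\<^esub> v"
    using connected assms by (auto simp: connected_def strongly_connected_def)
  ultimately show ?thesis
    by (auto simp: reachable_def dest: rtrancl_on_rtranclI)
qed

text \<open>A walk from the triangle to \<open>x\<close> would at some point leave the near
  vertices, and a far vertex next to a near one has no far neighbour. So no edge with two far ends
  can ever be reached.\<close>

lemma far_edge_free:
  assumes T: "p \<sim> q" "q \<sim> r" "p \<sim> r" and xy: "x \<sim> y"
    and x: "\<not> x \<sim> p" "\<not> x \<sim> q" "\<not> x \<sim> r" and y: "\<not> y \<sim> p" "\<not> y \<sim> q" "\<not> y \<sim> r"
  shows False
proof -
  define far where "far u \<longleftrightarrow> \<not> u \<sim> p \<and> \<not> u \<sim> q \<and> \<not> u \<sim> r" for u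
  have near_step: "\<not> far w" if d: "\<not> far d" "d \<sim> u" "far u" "u \<sim> w" for d u w
  proof
    assume w: "far w"
    \<comment> \<open>Let \<open>a\<close> be a triangle vertex adjacent to \<open>d\<close>. If it
      is the only one, the triangle with the path \<open>a\<close>, \<open>d\<close>,
      \<open>u\<close> is a hammer. If \<open>d\<close> is also adjacent to \<open>b\<close>, the
      triangle \<open>d\<close>, \<open>a\<close>, \<open>b\<close> forms with \<open>u\<close> and
      \<open>w\<close> a butterfly when \<open>d \<sim> w\<close> and a hammer otherwise; likewise
      for \<open>c\<close>.\<close>
    have contra: False
      if T': "a \<sim> b" "b \<sim> c" "a \<sim> c" and da: "d \<sim> a"
        and u: "\<not> u \<sim> a" "\<not> u \<sim> b" "\<not> u \<sim> c" and w': "\<not> w \<sim> a" "\<not> w \<sim> b" "\<not> w \<sim> c"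
      for a b c
    proof -
      have two: False if b: "d \<sim> b" "a \<sim> b" "\<not> u \<sim> b" "\<not> w \<sim> b" for b
        using no_butterfly[of d a b u w] no_hammer[of a b d u w] b da d u w' arc_commute by metis
      have "d \<sim> b \<or> d \<sim> c"
        using no_hammer[of b c a d u] T' da d u arc_commute by metis
      then show False
        using two T' u w' by metis
    qed
    \<comment> \<open>The rotations cover the three possible neighbours of \<open>d\<close> in the
      triangle.\<close>
    show False
      using d(1,3) w contra[of p q r] contra[of q r p] contra[of r p q] T
      unfolding far_def by (metis arc_commute)
  qed
  have "(p, x) \<in> (parcs G)\<^sup>*"
    using T xy in_arcsD1 by (intro reachable_in_connected) auto
  \<comment> \<open>The invariant along the walk. It holds at \<open>p\<close>, which is adjacent to
    \<open>q\<close>. A step from a near vertex uses \<open>near_step\<close>; a step from a far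
    vertex leads to a near one.\<close>
  then have "\<not> far x \<or> (\<forall>w. x \<sim> w \<longrightarrow> \<not> far w)"
  proof (induction rule: rtrancl_induct)
    case base
    show ?case using T by (auto simp: far_def)
  next
    case (step u v)
    then show ?case using near_step by blast
  qed
  then show False
    using x y xy unfolding far_def by blast
qed

text \<open>An edge \<open>xy\<close> is sorted by its adjacency to \<open>r\<close>: two edges to
  \<open>r\<close> give a butterfly centred at \<open>r\<close>, one gives a hammer whose tail
  starts at \<open>r\<close>, and none makes \<open>xy\<close> far from the whole triangle.\<close>

lemma common_nonneighbours_independent:
  assumes T: "p \<sim> q" "q \<sim> r" "p \<sim> r"
    and x: "\<not> x \<sim> p" "\<not> x \<sim> q" and y: "\<not> y \<sim> p" "\<not> y \<sim> q"
  shows "\<not> x \<sim> y"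
proof
  assume xy: "x \<sim> y"
  show False
  proof (cases "x \<sim> r"; cases "y \<sim> r")
    assume "x \<sim> r" "y \<sim> r"
    then show False
      using no_butterfly[of r p q x y] T x y xy arc_commute by metis
  next
    assume "x \<sim> r" "\<not> y \<sim> r"
    then show False
      using no_hammer[of p q r x y] T x y xy arc_commute by metis
  next
    assume "\<not> x \<sim> r" "y \<sim> r"
    then show False
      using no_hammer[of p q r y x] T x y xy arc_commute by metis
  next
    assume "\<not> x \<sim> r" "\<not> y \<sim> r"
    then show False
      using far_edge_free[OF T xy x(1,2) _ y(1,2)] by blast
  qed
qed

text \<open>Any three of the four vertices contain both ends of one edge, say \<open>z\<close>,
  \<open>w\<close>, and one end \<open>x\<close> of the other. If \<open>t\<close> sees all three,
  then \<open>t\<close>, \<open>z\<close>, \<open>w\<close> is a triangle, and \<open>y\<close>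
  completes a butterfly or a hammer. The bound is written as a sum so that it can be added up over
  several \<open>t\<close>.\<close>

lemma induced_two_K2_misses_two:
  assumes "x \<sim> y" "z \<sim> w" "\<not> x \<sim> z" "\<not> x \<sim> w" "\<not> y \<sim> z" "\<not> y \<sim> w"
  shows "of_bool (x \<sim> t) + of_bool (y \<sim> t) + of_bool (z \<sim> t) + of_bool (w \<sim> t) \<le> (2::nat)"
proof -
  have *: "\<not> (z \<sim> t \<and> w \<sim> t \<and> x \<sim> t)"
    if "x \<sim> y" "z \<sim> w" "\<not> x \<sim> z" "\<not> x \<sim> w" "\<not> y \<sim> z" "\<not> y \<sim> w" for x y z w
    using no_butterfly[of t z w x y] no_hammer[of z w t x y] that arc_commute by metis
  have "\<not> (z \<sim> t \<and> w \<sim> t \<and> x \<sim> t)" "\<not> (z \<sim> t \<and> w \<sim> t \<and> y \<sim> t)"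
    "\<not> (x \<sim> t \<and> y \<sim> t \<and> z \<sim> t)" "\<not> (x \<sim> t \<and> y \<sim> t \<and> w \<sim> t)"
    using *[of x y z w] *[of y x z w] *[of z w x y] *[of w z x y] assms arc_commute by metis+
  then show ?thesis
    by (auto simp: of_bool_def)
qed

end

section \<open>Colourings and cliques of an induced subgraph\<close>

lemma (in pair_graph) ex_colorable: "\<exists>k. colorable G k"
proof -
  obtain c :: "'a \<Rightarrow> nat" and n where c: "c ` pverts G = {i. i < n}" "inj_on c (pverts G)"
    using finite_imp_inj_to_nat_seg[OF pair_finite_verts] by metis
  have "colorable G n"
    unfolding colorable_def
  proof (intro exI[of _ c] conjI ballI)
    show "c v < n" if "v \<in> pverts G" for v
      using c(1) that by blast
    fix e assume e: "e \<in> parcs G"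
    then have "fst e \<in> pverts G" "snd e \<in> pverts G" "fst e \<noteq> snd e"
      using in_arcsD1 in_arcsD2 no_loops' by (cases e; auto)+
    then show "case e of (u, v) \<Rightarrow> c u \<noteq> c v"
      using c(2) by (auto dest: inj_onD)
  qed
  then show ?thesis by blast
qed

lemma (in pair_graph) finite_cliques: "finite {K. is_clique G K}"
  by (rule finite_subset[of _ "Pow (pverts G)"]) (auto simp: is_clique_def pair_finite_verts)

lemma (in pair_graph) card_le_clique_number: "is_clique G K \<Longrightarrow> card K \<le> clique_number G"
  unfolding clique_number_def using finite_cliques by (intro Max_ge) auto

lemma (in pair_graph) ex_maximum_clique:
  obtains K where "is_clique G K" "card K = clique_number G"
proof -
  \<comment> \<open>The empty clique makes the set under \<open>Max\<close> nonempty, even for a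
    graph without vertices.\<close>
  have "is_clique G {}"
    by (simp add: is_clique_def)
  then have "clique_number G \<in> card ` {K. is_clique G K}"
    unfolding clique_number_def using finite_cliques by (intro Max_in) auto
  then show ?thesis using that by auto
qed

text \<open>The subgraph induced by \<open>A\<close> falls under the binding function and has the
  clique number of \<open>G\<close>, thanks to \<open>K\<close>. Its colouring is extended by one
  new colour for each of the three independent sets, which may overlap.\<close>

lemma (in pair_graph) chromatic_number_le_three_independent:
  assumes H: "pair_wf_digraph H"
    and f: "chi_binding (\<lambda>G'. induced_free two_K2 G' \<and> induced_free H G') f"
    and HG: "induced_free H G"
    and A: "A \<subseteq> pverts G" and K: "is_clique G K" "card K = clique_number G" "K \<subseteq> A"
    and no_2K2: "\<And>x y z w. \<lbrakk>{x, y, z, w} \<subseteq> A; (x, y) \<in> parcs G; (z, w) \<in> parcs G;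
      (x, z) \<notin> parcs G; (x, w) \<notin> parcs G; (y, z) \<notin> parcs G; (y, w) \<notin> parcs G\<rbrakk> \<Longrightarrow> False"
    and cover: "pverts G - A \<subseteq> I \<union> J \<union> L"
    and indep: "\<And>u v. u \<in> I \<Longrightarrow> v \<in> I \<Longrightarrow> (u, v) \<notin> parcs G"
      "\<And>u v. u \<in> J \<Longrightarrow> v \<in> J \<Longrightarrow> (u, v) \<notin> parcs G"
      "\<And>u v. u \<in> L \<Longrightarrow> v \<in> L \<Longrightarrow> (u, v) \<notin> parcs G"
  shows "real (chromatic_number G) \<le> f (clique_number G) + 3"
proof -
  have "finite A"
    using A pair_finite_verts finite_subset by blast
  then obtain h :: "'a \<Rightarrow> nat" where h: "inj_on h A"
    using finite_imp_inj_to_nat_seg by metis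
  have h_eq: "u = v" if "h u = h v" "u \<in> A" "v \<in> A" for u v
    using h that by (auto dest: inj_onD)
  \<comment> \<open>\<open>chi_binding\<close> speaks only of graphs with vertices in
    \<open>nat\<close>, so the subgraph induced by \<open>A\<close> is transported there along
    \<open>h\<close>.\<close>
  define G' where "G' = \<lparr>pverts = h ` A,
    parcs = {(h u, h v) | u v. u \<in> A \<and> v \<in> A \<and> (u, v) \<in> parcs G}\<rparr>"
  have arc: "(h u, h v) \<in> parcs G' \<longleftrightarrow> (u, v) \<in> parcs G" if "u \<in> A" "v \<in> A" for u v
    using that h_eq by (auto simp: G'_def)
  have "parcs G' \<subseteq> pverts G' \<times> pverts G'"
    by (auto simp: G'_def)
  then have "finite (parcs G')"
    by (rule finite_subset) (simp add: G'_def \<open>finite A\<close>)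
  then interpret G': pair_graph G'
  proof unfold_locales
    show "symmetric (with_proj G')"
      using arcs_symmetric by (auto simp: symmetric_def G'_def intro!: symI)
    show "fst e \<noteq> snd e" if "e \<in> parcs G'" for e
      using that h_eq no_loops' by (fastforce simp: G'_def)
  qed (auto simp: G'_def \<open>finite A\<close>)
  have emb: "embeds G' G"
    unfolding embeds_def
    using h A arc by (intro exI[of _ "the_inv_into A h"])
      (auto simp: G'_def the_inv_into_f_f inj_on_def)
  have "\<not> embeds H G"
    using HG induced_free_iff_not_embeds[OF H pair_wf_digraph] by blast
  then have "induced_free H G'"
    using embeds_trans[OF _ emb] induced_free_iff_not_embeds[OF H G'.pair_wf_digraph] by blast
  moreover have "\<not> embeds two_K2 G'"
  proof
    assume "embeds two_K2 G'"
    then obtain g where g: "g ` {0, 1, 2, 3} \<subseteq> pverts G'"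
      "\<And>u v. u \<in> {0, 1, 2, 3} \<Longrightarrow> v \<in> {0, 1, 2, 3} \<Longrightarrow>
        (u, v) \<in> parcs two_K2 \<longleftrightarrow> (g u, g v) \<in> parcs G'"
      unfolding embeds_def two_K2_def pverts_undirected by metis
    obtain x y z w where e: "g 0 = h x" "g 1 = h y" "g 2 = h z" "g 3 = h w"
        "{x, y, z, w} \<subseteq> A"
      using g(1) by (auto simp: G'_def)
    show False
      using no_2K2[of x y z w] e g(2)[of 0 1] g(2)[of 2 3] g(2)[of 0 2] g(2)[of 0 3]
        g(2)[of 1 2] g(2)[of 1 3] arc
      by (auto simp: two_K2_def parcs_undirected)
  qed
  then have "induced_free two_K2 G'"
    using induced_free_iff_not_embeds[OF wf_two_K2 G'.pair_wf_digraph] by blast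
  ultimately have bound: "real (chromatic_number G') \<le> f (clique_number G')"
    using f G'.pair_graph unfolding chi_binding_def by blast
  have "clique_number G' = clique_number G"
  proof (rule antisym)
    have "is_clique G' (h ` K)"
      unfolding is_clique_def
    proof (intro conjI ballI impI)
      show "h ` K \<subseteq> pverts G'"
        using K(3) by (auto simp: G'_def)
      fix a b assume "a \<in> h ` K" "b \<in> h ` K" "a \<noteq> b"
      then obtain u v where "u \<in> K" "v \<in> K" "u \<noteq> v" "a = h u" "b = h v"
        by blast
      then show "(a, b) \<in> parcs G'"
        using K(1,3) arc[of u v] by (auto simp: is_clique_def)
    qed
    moreover have "card (h ` K) = card K"
      using h K(3) by (meson card_image inj_on_subset)
    ultimately show "clique_number G \<le> clique_number G'"
      using G'.card_le_clique_number K(2) by metis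
    \<comment> \<open>Conversely, a maximum clique of the copy is pulled back along \<open>h\<close>
      to a clique of \<open>G\<close>.\<close>
    obtain K' where K': "is_clique G' K'" "card K' = clique_number G'"
      by (rule G'.ex_maximum_clique)
    then obtain B where B: "B \<subseteq> A" "K' = h ` B"
      unfolding is_clique_def G'_def by (auto simp: subset_image_iff)
    have "is_clique G B"
      unfolding is_clique_def
    proof (intro conjI ballI impI)
      show "B \<subseteq> pverts G" using A B by blast
      fix u v assume uv: "u \<in> B" "v \<in> B" "u \<noteq> v"
      then have "u \<in> A" "v \<in> A"
        using B(1) by auto
      then have "h u \<noteq> h v"
        using uv(3) h_eq by blast
      then have "(h u, h v) \<in> parcs G'"
        using K'(1) uv(1,2) by (simp add: is_clique_def B(2))
      then show "(u, v) \<in> parcs G"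
        using arc[OF \<open>u \<in> A\<close> \<open>v \<in> A\<close>] by simp
    qed
    moreover have "card B = card K'"
      using card_image[OF inj_on_subset[OF h B(1)]] B(2) by simp
    ultimately show "clique_number G' \<le> clique_number G"
      using card_le_clique_number K'(2) by metis
  qed
  moreover have "chromatic_number G \<le> chromatic_number G' + 3"
  proof -
    let ?k = "chromatic_number G'"
    have "colorable G' ?k"
      unfolding chromatic_number_def using G'.ex_colorable by (rule LeastI_ex)
    then obtain c where c: "\<And>v. v \<in> pverts G' \<Longrightarrow> c v < ?k"
        "\<And>u v. (u, v) \<in> parcs G' \<Longrightarrow> c u \<noteq> c v"
      unfolding colorable_def by fast
    \<comment> \<open>The order of the tests settles overlaps. By \<open>cover\<close>, a vertex of
      \<open>G\<close> reaching the last branch lies in \<open>L\<close>. Colours on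
      \<open>A\<close> stay below \<open>?k\<close>, so they never clash with the three new
      ones.\<close>
    define c' where "c' v = (if v \<in> A then c (h v) else if v \<in> I then ?k
      else if v \<in> J then ?k + 1 else ?k + 2)" for v
    have cA: "c (h v) < ?k" if "v \<in> A" for v
      using c(1) that by (simp add: G'_def)
    have "colorable G (?k + 3)"
      unfolding colorable_def
    proof (intro exI[of _ c'] conjI ballI)
      show "c' v < ?k + 3" for v
        using cA[of v] by (auto simp: c'_def)
      fix e assume "e \<in> parcs G"
      moreover obtain u v where "e = (u, v)" by fastforce
      ultimately have uv: "e = (u, v)" "(u, v) \<in> parcs G" by auto
      then have "u \<in> pverts G" "v \<in> pverts G"
        using in_arcsD1 in_arcsD2 by auto
      then have "u \<in> A \<union> I \<union> J \<union> L" "v \<in> A \<union> I \<union> J \<union> L"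
        using cover by auto
      then have "c' u \<noteq> c' v"
        using uv(2) indep[of u v] cA[of u] cA[of v] c(2)[of "h u" "h v"] arc[of u v]
        by (auto simp: c'_def split: if_splits)
      then show "case e of (u, v) \<Rightarrow> c' u \<noteq> c' v"
        using uv(1) by simp
    qed
    then show ?thesis
      unfolding chromatic_number_def by (rule Least_le)
  qed
  ultimately show ?thesis
    using bound by simp
qed

section \<open>The triangle in a maximum clique and the resulting bound\<close>

theorem corollary3p3:
  fixes H :: "'h pair_pre_digraph" and f :: "nat \<Rightarrow> real" and G :: "'a pair_pre_digraph"
  assumes "pair_graph H"
    and "chi_binding (\<lambda>G'. induced_free two_K2 G' \<and> induced_free H G') f"
    and "pair_graph G" and "connected (with_proj G)"
    and "induced_free butterfly G" and "induced_free hammer G" and "induced_free H G"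
    and "clique_number G \<noteq> 2"
  shows "real (chromatic_number G) \<le> f (clique_number G) + 3"
proof -
  interpret H: pair_graph H by fact
  interpret butterfly_hammer_free G
    using assms by (simp add: butterfly_hammer_free_def butterfly_hammer_free_axioms_def)
  obtain K where K: "is_clique G K" "card K = clique_number G"
    by (rule ex_maximum_clique)
  note reduce = chromatic_number_le_three_independent[OF H.pair_wf_digraph assms(2,7) _ K]
  show ?thesis
  proof (cases "clique_number G < 3")
    case True
    \<comment> \<open>Excluding clique number 2 leaves only edgeless graphs here, so
      \<open>A\<close> can be the whole vertex set and the three extra sets empty.\<close>
    then have "clique_number G < 2"
      using assms(8) by simp
    moreover have "2 \<le> clique_number G" if "(u, v) \<in> parcs G" for u v
    proof -
      have "is_clique G {u, v}"
        using that arcs_symmetric in_arcsD1 in_arcsD2 by (auto simp: is_clique_def)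
      then show ?thesis
        using card_le_clique_number[of "{u, v}"] no_loops'[OF that] by simp
    qed
    ultimately have "(u, v) \<notin> parcs G" for u v
      by (meson not_less)
    then show ?thesis
      using K(1) by (intro reduce[of "pverts G" "{}" "{}" "{}"]) (auto simp: is_clique_def)
  next
    case False
    then have "3 \<le> card K"
      using K(2) by simp
    then obtain T where "T \<subseteq> K" "card T = 3"
      by (meson obtain_subset_with_card_n)
    then obtain p q r where pqr: "{p, q, r} \<subseteq> K" "p \<noteq> q" "q \<noteq> r" "p \<noteq> r"
      by (auto simp: card_3_iff)
    then have T: "p \<sim> q" "q \<sim> r" "p \<sim> r"
      using K(1) by (auto simp: is_clique_def)
    define M where "M s t = {u \<in> pverts G. \<not> u \<sim> s \<and> \<not> u \<sim> t}" for s t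
    have A_deg: "2 \<le> of_bool (u \<sim> p) + of_bool (u \<sim> q) + (of_bool (u \<sim> r) :: nat)"
      if "u \<in> pverts G - (M p q \<union> M q r \<union> M p r)" for u
      using that by (auto simp: M_def of_bool_def)
    show ?thesis
    proof (rule reduce[of "pverts G - (M p q \<union> M q r \<union> M p r)" "M p q" "M q r" "M p r"])
      \<comment> \<open>A vertex of the clique can miss at most itself among \<open>p\<close>,
        \<open>q\<close>, \<open>r\<close>, so it lies in none of the three sets
        \<open>M\<close>.\<close>
      show "K \<subseteq> pverts G - (M p q \<union> M q r \<union> M p r)"
      proof
        fix x assume x: "x \<in> K"
        then have "x = t \<or> x \<sim> t" if "t \<in> {p, q, r}" for t
          using K(1) pqr(1) that by (auto simp: is_clique_def)
        then show "x \<in> pverts G - (M p q \<union> M q r \<union> M p r)"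
          using x K(1) pqr(2-4) by (auto simp: is_clique_def M_def)
      qed
      show False
        if "{x, y, z, w} \<subseteq> pverts G - (M p q \<union> M q r \<union> M p r)"
          "x \<sim> y" "z \<sim> w" "\<not> x \<sim> z" "\<not> x \<sim> w" "\<not> y \<sim> z" "\<not> y \<sim> w" for x y z w
      proof -
        \<comment> \<open>Count adjacencies between the four vertices and \<open>p\<close>,
          \<open>q\<close>, \<open>r\<close>: \<open>A_deg\<close> gives at least 4 * 2 = 8, while
          \<open>induced_two_K2_misses_two\<close> gives at most 3 * 2 = 6.\<close>
        have "x \<in> pverts G - (M p q \<union> M q r \<union> M p r)" "y \<in> pverts G - (M p q \<union> M q r \<union> M p r)"
          "z \<in> pverts G - (M p q \<union> M q r \<union> M p r)" "w \<in> pverts G - (M p q \<union> M q r \<union> M p r)"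
          using that(1) by blast+
        note this[THEN A_deg]
        then show False
          using induced_two_K2_misses_two[OF that(2-7), of p]
          induced_two_K2_misses_two[OF that(2-7), of q]
          induced_two_K2_misses_two[OF that(2-7), of r]
          by linarith
      qed
      show "(u, v) \<notin> parcs G" if "u \<in> M p q" "v \<in> M p q" for u v
        using common_nonneighbours_independent[OF T] that by (auto simp: M_def)
      show "(u, v) \<notin> parcs G" if "u \<in> M q r" "v \<in> M q r" for u v
        using common_nonneighbours_independent[of q r p] T that arc_commute by (auto simp: M_def)
      show "(u, v) \<notin> parcs G" if "u \<in> M p r" "v \<in> M p r" for u v
        using common_nonneighbours_independent[of p r q] T that arc_commute by (auto simp: M_def)
    qed auto
  qed
qed

end
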